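(* For each integer $n\geq 1$ there is a bijection $$\phi:\mathcal{F}_n\to\mathcal{T}_n,\qquad F\mapsto T=\phi(F),$$ such that $\delta(F)=\varepsilon(T)$ for every $F\in\mathcal{F}_n$.
   Context: Let $[n]=\{1,2,\ldots,n\}$, let $\mathcal{S}_n$ be the symmetric group on $[n]$, and let $\mathcal{C}_n=(1\,2\,\ldots\,n)\in\mathcal{S}_n$. Products of permutations are composed from right to left (the rightmost factor acts first). $\mathcal{T}_n$ is the set of labelled trees with vertex set $[n]$. $\mathcal{F}_n$ is the set of factorizations: ordered $(n-1)$-tuples $(\sigma_1,\ldots,\sigma_{n-1})$ of transpositions in $\mathcal{S}_n$ with $\sigma_1\cdots\sigma_{n-1}=\mathcal{C}_n$. The transpositions $\sigma_1,\ldots,\sigma_{n-1}$ are called the factors. (For $n=1$ the only factorization is the empty tuple.) For a tree $T\in\mathcal{T}_n$ and an edge of $T$, deleting the edge leaves two components, with $t_1$ and $t_2$ vertices ($t_1+t_2=n$); the edge-deletion index of the edge is $\min\{t_1,t_2\}$. The edge-deletion distribution of $T$ is $\varepsilon(T)=(a_1,a_2,\ldots)$, where $a_j$ is the number of edges of $T$ with edge-deletion index $j$. For a transposition $(s\ t)$ on $[n]$ with $s<t$, the difference index is $\min\{t-s,\,n-t+s\}$. The difference distribution of $F\in\mathcal{F}_n$ is $\delta(F)=(d_1,d_2,\ldots)$, where $d_j$ is the number of indices $i\in\{1,\ldots,n-1\}$ such that the factor $\sigma_i$ has difference index $j$. *)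

theory Defs
  imports "HOL-Combinatorics.Cycles"
begin

text \<open>
  An undirected simple graph is given by its vertex set \<open>V\<close> and its set \<open>E\<close> of edges, which are
  two-element subsets of \<open>V\<close>.
\<close>

definition simple_graph :: "'a set \<Rightarrow> 'a set set \<Rightarrow> bool" where
  "simple_graph V E \<longleftrightarrow> finite V \<and> (\<forall>e\<in>E. e \<subseteq> V \<and> card e = 2)"

definition graph_connection :: "'a set \<Rightarrow> 'a set set \<Rightarrow> 'a rel" where
  "graph_connection V E = {(u, v). u \<in> V \<and> v \<in> V \<and> (u, v) \<in> {(x, y). {x, y} \<in> E}\<^sup>*}"

definition graph_components :: "'a set \<Rightarrow> 'a set set \<Rightarrow> 'a set set" where
  "graph_components V E = V // graph_connection V E"

definition connected_graph :: "'a set \<Rightarrow> 'a set set \<Rightarrow> bool" where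
  "connected_graph V E \<longleftrightarrow> V \<noteq> {} \<and> (\<forall>u\<in>V. \<forall>v\<in>V. (u, v) \<in> graph_connection V E)"

text \<open>The closing edge of the cycle is the one obtained for \<open>i = length vs - 1\<close>.\<close>

definition graph_cycle :: "'a set set \<Rightarrow> 'a list \<Rightarrow> bool" where
  "graph_cycle E vs \<longleftrightarrow> 3 \<le> length vs \<and> distinct vs \<and>
     (\<forall>i<length vs. {vs ! i, vs ! (Suc i mod length vs)} \<in> E)"

definition tree_graph :: "'a set \<Rightarrow> 'a set set \<Rightarrow> bool" where
  "tree_graph V E \<longleftrightarrow> simple_graph V E \<and> connected_graph V E \<and> (\<nexists>vs. graph_cycle E vs)"

text \<open>As the vertex set is fixed, a labelled tree is identified with its edge set.\<close>

definition labelled_trees :: "nat \<Rightarrow> nat set set set" where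
  "labelled_trees n = {T. tree_graph {1..n} T}"

definition edge_deletion_index :: "nat \<Rightarrow> nat set set \<Rightarrow> nat set \<Rightarrow> nat" where
  "edge_deletion_index n T e = Min (card ` graph_components {1..n} (T - {e}))"

text \<open>
  Distributions are functions of \<open>j\<close>; all indices being counted are positive, so the entry at
  \<open>j = 0\<close> is always \<open>0\<close>.
\<close>

definition edge_deletion_distribution :: "nat \<Rightarrow> nat set set \<Rightarrow> nat \<Rightarrow> nat" where
  "edge_deletion_distribution n T j = card {e \<in> T. edge_deletion_index n T e = j}"

definition transpositions :: "nat \<Rightarrow> (nat \<Rightarrow> nat) set" where
  "transpositions n = {transpose s t | s t. s \<in> {1..n} \<and> t \<in> {1..n} \<and> s < t}"

definition full_cycle :: "nat \<Rightarrow> nat \<Rightarrow> nat" where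
  "full_cycle n = cycle_of_list [1..<Suc n]"

text \<open>The list \<open>[\<sigma>\<^sub>1, \<dots>, \<sigma>\<^sub>m]\<close> has product \<open>\<sigma>\<^sub>1 \<circ> \<dots> \<circ> \<sigma>\<^sub>m\<close>, in which \<open>\<sigma>\<^sub>m\<close> acts first.\<close>

definition factorizations :: "nat \<Rightarrow> (nat \<Rightarrow> nat) list set" where
  "factorizations n = {F. length F = n - 1 \<and> set F \<subseteq> transpositions n \<and>
     foldr (\<circ>) F id = full_cycle n}"

definition difference_index :: "nat \<Rightarrow> (nat \<Rightarrow> nat) \<Rightarrow> nat" where
  "difference_index n \<sigma> = (THE d. \<exists>s\<in>{1..n}. \<exists>t\<in>{1..n}. s < t \<and> \<sigma> = transpose s t \<and>
     d = min (t - s) (n - t + s))"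

definition difference_distribution :: "nat \<Rightarrow> (nat \<Rightarrow> nat) list \<Rightarrow> nat \<Rightarrow> nat" where
  "difference_distribution n F j =
     card {i. i < length F \<and> difference_index n (F ! i) = j}"

lemma difference_index_transpose:
  assumes "1 \<le> s" "s < t" "t \<le> n"
  shows "difference_index n (transpose s t) = min (t - s) (n - t + s)"
proof -
  have uniq: "s' = s \<and> t' = t" if "s' < t'" "transpose s t = transpose s' t'" for s' t'
  proof -
    have "transpose s' t' s = t" "transpose s' t' t = s"
      by (simp_all flip: that(2))
    then show ?thesis
      using that(1) assms(2) by (auto simp: transpose_def split: if_splits)
  qed
  show ?thesis
    unfolding difference_index_def
  proof (rule the_equality)
    show "\<exists>s'\<in>{1..n}. \<exists>t'\<in>{1..n}. s' < t' \<and> transpose s t = transpose s' t' \<and>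
        min (t - s) (n - t + s) = min (t' - s') (n - t' + s')"
      using assms by (intro bexI[of _ s] bexI[of _ t]) auto
  next
    fix d
    assume "\<exists>s'\<in>{1..n}. \<exists>t'\<in>{1..n}. s' < t' \<and> transpose s t = transpose s' t' \<and>
        d = min (t' - s') (n - t' + s')"
    then show "d = min (t - s) (n - t + s)"
      using uniq by blast
  qed
qed

lemma full_cycle_apply:
  assumes "i \<in> {1..n}"
  shows "full_cycle n i = (if i = n then 1 else Suc i)"
proof -
  have i: "i - 1 < length [1..<Suc n]"
    using assms by (simp del: upt_Suc) linarith
  have "map (full_cycle n) [1..<Suc n] = rotate1 [1..<Suc n]"
    using cyclic_rotation[of "[1..<Suc n]" 1] by (simp add: full_cycle_def)
  then have "map (full_cycle n) [1..<Suc n] ! (i - 1) = rotate1 [1..<Suc n] ! (i - 1)"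
    by simp
  moreover have "map (full_cycle n) [1..<Suc n] ! (i - 1) = full_cycle n i"
    using assms i by (subst nth_map) (simp_all del: upt_Suc)
  moreover have "rotate1 [1..<Suc n] ! (i - 1) = [1..<Suc n] ! (Suc (i - 1) mod n)"
    using assms i by (subst nth_rotate1) (simp_all del: upt_Suc)
  moreover have "[1..<Suc n] ! (Suc (i - 1) mod n) = (if i = n then 1 else Suc i)"
    proof (cases "i = n")
    case True
    then show ?thesis
      using assms by (simp del: upt_Suc)
  next
    case False
    then show ?thesis
      using assms by (simp del: upt_Suc)
  qed
  ultimately show ?thesis
    by simp
qed

end

theory Submission
  imports Defs "HOL-Combinatorics.Orbits"
begin

text \<open>
  Draw the factors \<open>\<sigma>\<^sub>i = (s t)\<close> of a factorization as chords of a circle that carries the points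
  \<open>1, \<dots>, n\<close>. The chords form a noncrossing tree and cut the disc into \<open>n\<close> regions, each of which
  touches one of the \<open>n\<close> arcs between consecutive points. The dual graph, which joins regions
  across chords, is a tree whose edges carry the numbers \<open>1, \<dots>, n - 1\<close>. Deleting the \<open>i\<close>-th edge
  separates the \<open>t - s\<close> arcs on one side of the chord from the \<open>n - t + s\<close> arcs on the other, which is
  the equality of the two indices. The dual tree is rooted at the region of the arc from \<open>n\<close> to \<open>1\<close>. The
  labelled tree is obtained by pushing the number of each edge to the end away from the root and
  giving the root the label \<open>n\<close>.

  The proof needs no planar geometry, because the dual tree has an algebraic description. The \<open>i\<close>-th
  dual edge is the transposition \<open>\<rho>\<^sub>i = V\<^sup>-\<^sup>1 \<sigma>\<^sub>i V\<close> with \<open>V = \<sigma>\<^sub>i\<^sub>+\<^sub>1 \<cdots> \<sigma>\<^sub>n\<^sub>-\<^sub>1\<close>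
  (\<open>hurwitz_dual\<close>), and \<open>\<rho>\<^sub>n\<^sub>-\<^sub>1 \<cdots> \<rho>\<^sub>1\<close> is again the full cycle. This correspondence between
  factorizations and factorizations in the opposite order is invertible. As the product is
  transitive and there are only \<open>n - 1\<close> factors, the \<open>\<rho>\<^sub>i\<close> are the edges of a tree
  (\<open>dual_tree_exists\<close>). Conversely, the transpositions along the edges of any tree multiply to a
  cycle of length \<open>n\<close> (\<open>tree_product_cyclic\<close>), and exactly one relabelling of the vertices that fixes the
  root turns it into the full cycle (\<open>conjugator_exists\<close>, \<open>conjugator_unique\<close>). So, up to renaming the
  vertices other than the root, edge-numbered trees are in bijection with factorizations. They are
  also in bijection with labelled trees, since the numbers on the edges are equivalent to labels on
  the vertices other than the root.

  For the indices, omitting \<open>\<rho>\<^sub>i\<close> from the product leaves \<open>\<sigma>\<^sub>i\<close> times the full cycle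
  (\<open>hurwitz_dual_delete\<close>). This permutation has two cycles, of lengths \<open>t - s\<close> and \<open>n - t + s\<close>, and they
  are the components that remain when the \<open>i\<close>-th edge is deleted.

  Trees are handled throughout as parent functions with respect to a root;
  \<open>tree_graph_iff_parents\<close> identifies these with connected graphs without cycles.
\<close>

section \<open>Trees as parent functions\<close>

definition adjacency :: "'a set set \<Rightarrow> 'a rel" where
  "adjacency E = {(x, y). {x, y} \<in> E}"

lemma in_adjacency [simp]: "(x, y) \<in> adjacency E \<longleftrightarrow> {x, y} \<in> E"
  by (simp add: adjacency_def)

lemma sym_adjacency: "sym (adjacency E)"
  by (auto simp: sym_def insert_commute)

lemma connected_sym: "(x, y) \<in> (adjacency E)\<^sup>* \<Longrightarrow> (y, x) \<in> (adjacency E)\<^sup>*"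
  using sym_rtrancl[OF sym_adjacency] by (rule symD)

lemma connected_mono: "E \<subseteq> E' \<Longrightarrow> (x, y) \<in> (adjacency E)\<^sup>* \<Longrightarrow> (x, y) \<in> (adjacency E')\<^sup>*"
  by (rule subsetD[OF rtrancl_mono]) auto

lemma connected_graph_iff_root:
  assumes "r \<in> V"
  shows "connected_graph V E \<longleftrightarrow> (\<forall>v\<in>V. (v, r) \<in> (adjacency E)\<^sup>*)"
  using assms connected_sym[of _ _ E]
  by (auto simp: connected_graph_def graph_connection_def simp flip: adjacency_def intro: rtrancl_trans)

text \<open>
  The decreasing function \<open>d\<close> is a certificate that following parents terminates, and then it can
  only end in \<open>r\<close>.
\<close>

definition rooted :: "'a set \<Rightarrow> 'a \<Rightarrow> ('a \<Rightarrow> 'a) \<Rightarrow> bool" where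
  "rooted V r p \<longleftrightarrow> finite V \<and> r \<in> V \<and>
     (\<exists>d::'a \<Rightarrow> nat. \<forall>v\<in>V - {r}. p v \<in> V \<and> d (p v) < d v)"

definition parent_edges :: "'a set \<Rightarrow> 'a \<Rightarrow> ('a \<Rightarrow> 'a) \<Rightarrow> 'a set set" where
  "parent_edges V r p = (\<lambda>v. {v, p v}) ` (V - {r})"

lemma rootedE:
  assumes "rooted V r p"
  obtains d :: "'a \<Rightarrow> nat" where "finite V" "r \<in> V"
    "\<And>v. v \<in> V \<Longrightarrow> v \<noteq> r \<Longrightarrow> p v \<in> V" "\<And>v. v \<in> V \<Longrightarrow> v \<noteq> r \<Longrightarrow> d (p v) < d v"
  using assms by (auto simp: rooted_def)

lemma rooted_parent_in: "rooted V r p \<Longrightarrow> v \<in> V \<Longrightarrow> v \<noteq> r \<Longrightarrow> p v \<in> V"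
  by (auto simp: rooted_def)

lemma rooted_parent_neq: "rooted V r p \<Longrightarrow> v \<in> V \<Longrightarrow> v \<noteq> r \<Longrightarrow> p v \<noteq> v"
  unfolding rooted_def by (metis Diff_iff less_irrefl singletonD)

text \<open>
  If two vertices had the same parent edge, each would be the parent of the other, and \<open>d\<close> would
  decrease along a closed walk of length two.
\<close>

lemma inj_on_parent_edge:
  assumes "rooted V r p"
  shows "inj_on (\<lambda>v. {v, p v}) (V - {r})"
proof (rule inj_onI)
  obtain d :: "'a \<Rightarrow> nat" where d: "\<And>v. v \<in> V \<Longrightarrow> v \<noteq> r \<Longrightarrow> d (p v) < d v"
    using rootedE[OF assms] by metis
  fix v w assume vw: "v \<in> V - {r}" "w \<in> V - {r}" "{v, p v} = {w, p w}"
  show "v = w"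
  proof (rule ccontr)
    assume "v \<noteq> w"
    then have "p v = w" "p w = v"
      using vw(3) by (auto simp: doubleton_eq_iff)
    then show False
      using d[of v] d[of w] vw by auto
  qed
qed

lemma card_parent_edges: "rooted V r p \<Longrightarrow> card (parent_edges V r p) = card V - 1"
  by (simp add: parent_edges_def card_image inj_on_parent_edge) (simp add: rooted_def)

text \<open>
  A vertex \<open>v\<close> of least depth with \<open>p v \<noteq> q v\<close> leads to a contradiction: the edge \<open>{v, p v}\<close> must be
  the \<open>q\<close>-edge of its other end \<open>p v\<close>, and \<open>p v\<close> is less deep, so its \<open>p\<close>-parent is \<open>v\<close> as well.
\<close>

lemma parents_unique:
  assumes p: "rooted V r p" and q: "rooted V r q"
    and eq: "parent_edges V r p = parent_edges V r q"
    and v: "v \<in> V" "v \<noteq> r"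
  shows "p v = q v"
proof -
  obtain d :: "'a \<Rightarrow> nat" where d: "\<And>v. v \<in> V \<Longrightarrow> v \<noteq> r \<Longrightarrow> d (p v) < d v"
    using rootedE[OF p] by metis
  show ?thesis
    using v
  proof (induction "d v" arbitrary: v rule: less_induct)
    case less
    show ?case
    proof (rule ccontr)
      assume neq: "p v \<noteq> q v"
      have "{v, p v} \<in> parent_edges V r q"
        using less.prems unfolding eq[symmetric] by (auto simp: parent_edges_def)
      then obtain w where w: "w \<in> V" "w \<noteq> r" "{v, p v} = {w, q w}"
        by (auto simp: parent_edges_def)
      then have *: "w = p v" "q w = v"
        using neq by (auto simp: doubleton_eq_iff)
      then have "p w = v"
        using less.hyps[of w] less.prems d w by auto
      then show False
        using d[of v] d[of w] * w less.prems by auto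
    qed
  qed
qed

lemma rooted_connected:
  assumes "rooted V r p" "v \<in> V"
  shows "(v, r) \<in> (adjacency (parent_edges V r p))\<^sup>*"
proof -
  obtain d :: "'a \<Rightarrow> nat" where d: "\<And>v. v \<in> V \<Longrightarrow> v \<noteq> r \<Longrightarrow> d (p v) < d v"
    using rootedE[OF assms(1)] by metis
  show ?thesis
    using assms(2)
  proof (induction "d v" arbitrary: v rule: less_induct)
    case less
    show ?case
    proof (cases "v = r")
      case False
      then have "(v, p v) \<in> adjacency (parent_edges V r p)"
        using less.prems by (auto simp: parent_edges_def)
      moreover have "(p v, r) \<in> (adjacency (parent_edges V r p))\<^sup>*"
        using less False d rooted_parent_in[OF assms(1)] by blast
      ultimately show ?thesis
        by (rule converse_rtrancl_into_rtrancl)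
    qed auto
  qed
qed

text \<open>
  Every connected graph contains a breadth-first spanning tree: the parent of a vertex is any
  neighbour that is closer to \<open>r\<close>.
\<close>

lemma connected_imp_parents:
  assumes "finite V" "r \<in> V" "\<And>e. e \<in> E \<Longrightarrow> e \<subseteq> V"
    and conn: "\<And>v. v \<in> V \<Longrightarrow> (v, r) \<in> (adjacency E)\<^sup>*"
  obtains p where "rooted V r p" "parent_edges V r p \<subseteq> E"
proof -
  define d where "d v = (LEAST k. (v, r) \<in> adjacency E ^^ k)" for v
  have "\<exists>w. {v, w} \<in> E \<and> d w < d v" if "v \<in> V - {r}" for v
  proof -
    have "\<exists>k. (v, r) \<in> adjacency E ^^ k"
      using conn[of v] that by (auto simp: rtrancl_power)
    then have dv: "(v, r) \<in> adjacency E ^^ d v"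
      unfolding d_def by (rule LeastI_ex)
    with that obtain m where m: "d v = Suc m"
      by (cases "d v") auto
    with dv obtain w where "(v, w) \<in> adjacency E" "(w, r) \<in> adjacency E ^^ m"
      using relpow_Suc_D2[of v r m "adjacency E"] by (auto simp del: relpow.simps)
    moreover from this have "d w \<le> m"
      unfolding d_def by (intro Least_le)
    ultimately show ?thesis
      using m by auto
  qed
  then obtain p where p: "\<And>v. v \<in> V - {r} \<Longrightarrow> {v, p v} \<in> E \<and> d (p v) < d v"
    by metis
  then have "p v \<in> V \<and> d (p v) < d v" if "v \<in> V - {r}" for v
    using assms(3)[of "{v, p v}"] that by simp
  then have "rooted V r p"
    using assms(1,2) unfolding rooted_def by blast
  with p that show thesis
    by (auto simp: parent_edges_def)
qed

text \<open>
  This is a counting argument. If deleting a parent edge left its ends connected, the remaining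
  graph would still be connected and so would contain a spanning tree with \<open>card V - 1\<close> edges, but
  only \<open>card V - 2\<close> edges are left.
\<close>

lemma parent_edge_is_bridge:
  assumes p: "rooted V r p" and v: "v \<in> V" "v \<noteq> r"
  shows "(v, p v) \<notin> (adjacency (parent_edges V r p - {{v, p v}}))\<^sup>*"
proof
  let ?E = "parent_edges V r p" and ?e = "{v, p v}"
  assume con: "(v, p v) \<in> (adjacency (?E - {?e}))\<^sup>*"
  have fin: "finite V" and r: "r \<in> V"
    using p by (auto simp: rooted_def)
  have sub: "e \<subseteq> V" if "e \<in> ?E - {?e}" for e
    using that rooted_parent_in[OF p] by (auto simp: parent_edges_def)
  have "adjacency ?E \<subseteq> (adjacency (?E - {?e}))\<^sup>*"
  proof (rule subrelI)
    fix a b assume "(a, b) \<in> adjacency ?E"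
    then show "(a, b) \<in> (adjacency (?E - {?e}))\<^sup>*"
      using con connected_sym[OF con]
      by (cases "{a, b} = ?e") (auto simp: doubleton_eq_iff)
  qed
  then have "(adjacency ?E)\<^sup>* \<subseteq> (adjacency (?E - {?e}))\<^sup>*"
    by (simp add: rtrancl_subset_rtrancl)
  then have "(u, r) \<in> (adjacency (?E - {?e}))\<^sup>*" if "u \<in> V" for u
    using rooted_connected[OF p that] by blast
  from connected_imp_parents[OF fin r sub this]
  obtain q where q: "rooted V r q" "parent_edges V r q \<subseteq> ?E - {?e}"
    by metis
  have "finite ?E"
    using fin by (simp add: parent_edges_def)
  moreover have "?e \<in> ?E"
    using v by (auto simp: parent_edges_def)
  ultimately have "card (parent_edges V r q) < card ?E"
    using q(2) by (intro psubset_card_mono) auto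
  then show False
    by (simp add: card_parent_edges p q)
qed

text \<open>
  A shortest path from \<open>x\<close> to \<open>y\<close> that avoids the edge \<open>{x, y}\<close> has no repeated vertices, and has at
  least two edges. The edge \<open>{x, y}\<close> closes it to a cycle.
\<close>

lemma cycle_through_non_bridge:
  assumes "x \<noteq> y" "{x, y} \<in> E" and con: "(x, y) \<in> (adjacency (E - {{x, y}}))\<^sup>*"
  obtains vs where "graph_cycle E vs"
proof -
  let ?R = "adjacency (E - {{x, y}})"
  define k where "k = (LEAST k. (x, y) \<in> ?R ^^ k)"
  have "\<exists>k. (x, y) \<in> ?R ^^ k"
    using con by (auto simp: rtrancl_power)
  then have "(x, y) \<in> ?R ^^ k"
    unfolding k_def by (rule LeastI_ex)
  then obtain f where f: "f 0 = x" "f k = y" "\<And>i. i < k \<Longrightarrow> (f i, f (Suc i)) \<in> ?R"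
    unfolding relpow_fun_conv by auto
  have path: "(f i, f (i + m)) \<in> ?R ^^ m" if "i + m \<le> k" for i m
    using that
  proof (induction m)
    case (Suc m)
    then have "(f i, f (i + m)) \<in> ?R ^^ m" "(f (i + m), f (Suc (i + m))) \<in> ?R"
      using f(3)[of "i + m"] by simp_all
    then have "(f i, f (Suc (i + m))) \<in> ?R ^^ Suc m"
      by (rule relpow_Suc_I)
    then show ?case
      by simp
  qed auto
  have inj: "f i \<noteq> f j" if "i < j" "j \<le> k" for i j
  proof
    assume eq: "f i = f j"
    have "(x, f j) \<in> ?R ^^ i"
      using path[of 0 i] that eq f(1) by simp
    moreover have "(f j, y) \<in> ?R ^^ (k - j)"
      using path[of j "k - j"] that f(2) by simp
    ultimately have "(x, y) \<in> ?R ^^ (i + (k - j))"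
      by (auto simp: relpow_add)
    then have "k \<le> i + (k - j)"
      unfolding k_def by (rule Least_le)
    then show False
      using that by simp
  qed
  have "k \<noteq> 0"
    using f assms(1) by (metis)
  moreover have "k \<noteq> 1"
    using f(3)[of 0] f(1,2) by auto
  ultimately have k: "2 \<le> k"
    by simp
  have "graph_cycle E (map f [0..<Suc k])"
    unfolding graph_cycle_def
  proof (intro conjI allI impI)
    show "3 \<le> length (map f [0..<Suc k])"
      using k by simp
    show "distinct (map f [0..<Suc k])"
      unfolding distinct_map inj_on_def using inj
      by (auto simp del: upt_Suc) (metis less_Suc_eq_le linorder_neqE_nat)
  next
    fix i assume "i < length (map f [0..<Suc k])"
    then have i: "i \<le> k"
      by simp
    show "{map f [0..<Suc k] ! i, map f [0..<Suc k] ! (Suc i mod length (map f [0..<Suc k]))} \<in> E"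
    proof (cases "i = k")
      case True
      then show ?thesis
        using assms(2) f by (simp add: insert_commute nth_append del: upt_Suc)
    next
      case False
      then show ?thesis
        using f(3)[of i] i by (simp add: nth_append del: upt_Suc)
    qed
  qed
  then show thesis
    by (rule that)
qed

lemma cycle_edge_not_bridge:
  assumes "graph_cycle E vs"
  obtains x y where "{x, y} \<in> E" "x \<noteq> y" "(x, y) \<in> (adjacency (E - {{x, y}}))\<^sup>*"
proof -
  define k where "k = length vs - 1"
  have len: "length vs = Suc k" "2 \<le> k" and dist: "distinct vs"
    and edge: "\<And>i. i < length vs \<Longrightarrow> {vs ! i, vs ! (Suc i mod length vs)} \<in> E"
    using assms by (auto simp: graph_cycle_def k_def)
  let ?x = "vs ! 0" and ?y = "vs ! k"
  have xy: "{?x, ?y} \<in> E" "?x \<noteq> ?y"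
    using edge[of k] len dist by (auto simp: insert_commute nth_eq_iff_index_eq)
  have "(?x, vs ! i) \<in> (adjacency (E - {{?x, ?y}}))\<^sup>*" if "i \<le> k" for i
    using that
  proof (induction i)
    case (Suc i)
    have "{vs ! i, vs ! Suc i} \<noteq> {?x, ?y}"
      using Suc.prems len dist by (auto simp: doubleton_eq_iff nth_eq_iff_index_eq)
    moreover have "{vs ! i, vs ! Suc i} \<in> E"
      using edge[of i] Suc.prems len by simp
    ultimately have "(vs ! i, vs ! Suc i) \<in> adjacency (E - {{?x, ?y}})"
      by simp
    moreover have "(?x, vs ! i) \<in> (adjacency (E - {{?x, ?y}}))\<^sup>*"
      using Suc by simp
    ultimately show ?case
      by (rule rtrancl_into_rtrancl[rotated])
  qed auto
  then show thesis
    using that[OF xy] by simp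
qed

text \<open>
  For the first direction, an edge outside a spanning tree would not be a bridge and so would lie on
  a cycle. Conversely, an edge of a cycle is not a bridge, but all parent edges are bridges.
\<close>

lemma tree_graph_iff_parents:
  assumes "finite V" "r \<in> V"
  shows "tree_graph V E \<longleftrightarrow> (\<exists>p. rooted V r p \<and> E = parent_edges V r p)"
proof
  assume tree: "tree_graph V E"
  then have E: "\<And>e. e \<in> E \<Longrightarrow> e \<subseteq> V \<and> card e = 2"
    by (auto simp: tree_graph_def simple_graph_def)
  have "(v, r) \<in> (adjacency E)\<^sup>*" if "v \<in> V" for v
    using tree that connected_graph_iff_root[OF assms(2)] by (simp add: tree_graph_def)
  with assms E obtain p where p: "rooted V r p" "parent_edges V r p \<subseteq> E"
    using connected_imp_parents[of V r E] by metis
  have "e \<in> parent_edges V r p" if "e \<in> E" for e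
  proof (rule ccontr)
    assume e: "e \<notin> parent_edges V r p"
    obtain x y where xy: "e = {x, y}" "x \<noteq> y"
      using E[OF \<open>e \<in> E\<close>] by (auto simp: card_2_iff)
    have "parent_edges V r p \<subseteq> E - {e}"
      using p(2) e by blast
    then have to_r: "(v, r) \<in> (adjacency (E - {e}))\<^sup>*" if "v \<in> V" for v
      using rooted_connected[OF p(1) that] by (rule connected_mono)
    have "x \<in> V" "y \<in> V"
      using E[OF that] xy(1) by auto
    then have "(x, y) \<in> (adjacency (E - {e}))\<^sup>*"
      using rtrancl_trans[OF to_r connected_sym[OF to_r]] by blast
    then have "(x, y) \<in> (adjacency (E - {{x, y}}))\<^sup>*"
      by (simp only: xy(1))
    moreover have "{x, y} \<in> E"
      using that xy(1) by simp
    ultimately obtain vs where "graph_cycle E vs"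
      using cycle_through_non_bridge[OF xy(2)] by metis
    then show False
      using tree by (auto simp: tree_graph_def)
  qed
  then show "\<exists>p. rooted V r p \<and> E = parent_edges V r p"
    using p by blast
next
  assume "\<exists>p. rooted V r p \<and> E = parent_edges V r p"
  then obtain p where p: "rooted V r p" and E: "E = parent_edges V r p"
    by blast
  have "simple_graph V E"
    using assms rooted_parent_in[OF p] rooted_parent_neq[OF p]
    by (force simp: simple_graph_def E parent_edges_def)
  moreover have "connected_graph V E"
    using rooted_connected[OF p] connected_graph_iff_root[OF assms(2)] by (simp add: E)
  moreover have "\<not> graph_cycle E vs" for vs
  proof
    assume "graph_cycle E vs"
    then obtain x y where xy: "{x, y} \<in> E" "(x, y) \<in> (adjacency (E - {{x, y}}))\<^sup>*"
      by (rule cycle_edge_not_bridge)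
    then obtain v where v: "v \<in> V" "v \<noteq> r" "{x, y} = {v, p v}"
      by (auto simp: E parent_edges_def)
    then have "(v, p v) \<in> (adjacency (E - {{v, p v}}))\<^sup>*"
      using xy(2) connected_sym[OF xy(2)] by (auto simp: doubleton_eq_iff insert_commute)
    then show False
      using parent_edge_is_bridge[OF p v(1,2)] by (simp add: E)
  qed
  ultimately show "tree_graph V E"
    by (simp add: tree_graph_def)
qed

lemma two_components:
  assumes A: "A \<subseteq> V" "A \<noteq> {}" "V - A \<noteq> {}"
    and conA: "\<And>x y. x \<in> A \<Longrightarrow> y \<in> A \<Longrightarrow> (x, y) \<in> (adjacency E)\<^sup>*"
    and conB: "\<And>x y. x \<in> V - A \<Longrightarrow> y \<in> V - A \<Longrightarrow> (x, y) \<in> (adjacency E)\<^sup>*"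
    and disc: "u \<in> V" "v \<in> V" "(u, v) \<notin> (adjacency E)\<^sup>*"
  shows "graph_components V E = {A, V - A}"
proof -
  have sep: "(x, y) \<notin> (adjacency E)\<^sup>*" if "x \<in> A" "y \<in> V - A" for x y
  proof
    assume xy: "(x, y) \<in> (adjacency E)\<^sup>*"
    have "(w, x) \<in> (adjacency E)\<^sup>*" if "w \<in> V" for w
    proof (cases "w \<in> A")
      case False
      then have "(w, y) \<in> (adjacency E)\<^sup>*"
        using conB \<open>y \<in> V - A\<close> that by blast
      then show ?thesis
        using connected_sym[OF xy] by (rule rtrancl_trans)
    qed (use conA \<open>x \<in> A\<close> in blast)
    then show False
      using disc rtrancl_trans[OF _ connected_sym, of u x E v] by blast
  qed
  have cls: "graph_connection V E `` {x} = (if x \<in> A then A else V - A)" if "x \<in> V" for x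
  proof (cases "x \<in> A")
    case True
    then show ?thesis
      using that conA[of x] sep[of x] A(1) by (auto simp: graph_connection_def simp flip: adjacency_def)
  next
    case False
    then have "(x, y) \<notin> (adjacency E)\<^sup>*" if "y \<in> A" for y
      using sep[of y x] that False \<open>x \<in> V\<close> connected_sym[of x y E] by auto
    then show ?thesis
      using that False conB[of x] by (auto simp: graph_connection_def simp flip: adjacency_def)
  qed
  have "graph_components V E = (\<Union>x\<in>V. {graph_connection V E `` {x}})"
    by (simp add: graph_components_def quotient_def)
  also have "\<dots> = (\<lambda>x. if x \<in> A then A else V - A) ` V"
    by (simp add: cls UNION_singleton_eq_range)
  also have "\<dots> = {A, V - A}"
    using A by auto
  finally show ?thesis .
qed

section \<open>Products of transpositions along a tree\<close>
lemma orbit_commute: "permutation f \<Longrightarrow> y \<in> orbit f x \<Longrightarrow> x \<in> orbit f y"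
  by (rule orbit_swap[OF permutation_self_in_orbit])

text \<open>
  Under \<open>g\<close> the vertex \<open>i\<close> is sent to \<open>f j\<close> and then runs through the \<open>f\<close>-orbit of \<open>j\<close> until it reaches
  \<open>j\<close> itself, because the only place where \<open>g\<close> could leave that orbit earlier is \<open>i\<close>. So the orbits
  of \<open>i\<close> and \<open>j\<close> are merged into one and nothing is torn apart.
\<close>

lemma join_orbits:
  assumes f: "permutation f" and ij: "i \<notin> orbit f j"
  defines "g \<equiv> f \<circ> transpose i j"
  shows "j \<in> orbit g i" "y \<in> orbit f x \<Longrightarrow> y \<in> orbit g x"
proof -
  have g: "permutation g"
    unfolding g_def by (intro permutation_compose f permutation_swap_id)
  have gi: "g i = f j" and gj: "g j = f i" and g_other: "\<And>x. x \<noteq> i \<Longrightarrow> x \<noteq> j \<Longrightarrow> g x = f x"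
    by (simp_all add: g_def)
  \<comment> \<open>On the \<open>f\<close>-orbit of \<open>j\<close> the two maps agree except at \<open>j\<close>, where \<open>f\<close> returns to \<open>f j = g i\<close>, the
    point at which the sweep began.\<close>
  have sweep: "z \<in> orbit g i" if "z \<in> orbit f j" for z
    using that
  proof induction
    case base
    then show ?case
      by (metis gi orbit.base)
  next
    case (step z)
    then have "z \<noteq> i"
      using ij by blast
    then show ?case
      using step by (metis gi g_other orbit.base orbit.step)
  qed
  then show j: "j \<in> orbit g i"
    using permutation_self_in_orbit[OF f] by blast
  then have i: "i \<in> orbit g j"
    using g by (rule orbit_commute[rotated])
  have one: "f x \<in> orbit g x" for x
  proof -
    consider "x = i" | "x = j" | "x \<noteq> i" "x \<noteq> j" by blast
    then show ?thesis
    proof cases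
      case 1
      then show ?thesis
        using j orbit.step[of j g i] by (simp add: gj)
    next
      case 2
      then show ?thesis
        using i orbit.step[of i g j] by (simp add: gi)
    next
      case 3
      then show ?thesis
        using orbit.base[of g x] by (simp add: g_other)
    qed
  qed
  show "y \<in> orbit g x" if "y \<in> orbit f x"
    using that by induction (use one orbit_trans in metis)+
qed

text \<open>
  The product of a list of permutations in which the first entry acts first, the opposite of the
  convention for factorizations.
\<close>

fun rev_product :: "('a \<Rightarrow> 'a) list \<Rightarrow> 'a \<Rightarrow> 'a" where
  "rev_product [] = id"
| "rev_product (r # R) = rev_product R \<circ> r"

lemma permutes_rev_product: "(\<And>r. r \<in> set R \<Longrightarrow> r permutes V) \<Longrightarrow> rev_product R permutes V"
proof (induction R)
  case (Cons r R)
  then have "r permutes V" "rev_product R permutes V"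
    by simp_all
  then show ?case
    unfolding rev_product.simps by (rule permutes_compose)
qed (simp add: permutes_id)

lemma orbit_rev_product_connected:
  assumes "\<And>r. r \<in> set R \<Longrightarrow> \<exists>i j. r = transpose i j \<and> {i, j} \<in> E"
    and "y \<in> orbit (rev_product R) x"
  shows "(x, y) \<in> (adjacency E)\<^sup>*"
proof -
  have one: "(x, rev_product R x) \<in> (adjacency E)\<^sup>*" for x
    using assms(1)
  proof (induction R arbitrary: x)
    case (Cons r R)
    obtain i j where r: "r = transpose i j" "{i, j} \<in> E"
      using Cons.prems[of r] by auto
    then have "(x, r x) \<in> (adjacency E)\<^sup>*"
      by (auto simp: transpose_def insert_commute)
    moreover have "(r x, rev_product R (r x)) \<in> (adjacency E)\<^sup>*"
      using Cons by simp
    ultimately show ?case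
      by (simp add: rtrancl_trans)
  qed simp
  show ?thesis
    using assms(2) by induction (use one rtrancl_trans in metis)+
qed

text \<open>
  The factors are multiplied one at a time, and each new edge joins vertices that are
  not connected by the edges already used, since parent edges are bridges. So each factor merges two
  orbits, and in the end the orbits contain the connected components.
\<close>

lemma connected_imp_orbit:
  assumes p: "rooted V r p" and "distinct is" "set is \<subseteq> V - {r}"
    and "(x, y) \<in> adjacency ((\<lambda>i. {i, p i}) ` set is)"
  shows "y \<in> orbit (rev_product (map (\<lambda>i. transpose i (p i)) is)) x"
  using assms(2-4)
proof (induction "is" arbitrary: x y)
  case (Cons i "is")
  let ?f = "rev_product (map (\<lambda>i. transpose i (p i)) is)" and ?E = "(\<lambda>i. {i, p i}) ` set is"
  have "?f permutes V"
    using Cons.prems rooted_parent_in[OF p] by (intro permutes_rev_product) (auto intro!: permutes_swap_id)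
  then have f: "permutation ?f"
    using p by (auto simp: rooted_def permutation_permutes)
  have i: "i \<in> V" "i \<noteq> r" "i \<notin> set is"
    using Cons.prems by auto
  have "{i, p i} \<notin> ?E"
    using inj_on_image_mem_iff[OF inj_on_parent_edge[OF p], of i "set is"] i Cons.prems(2) by simp
  then have "?E \<subseteq> parent_edges V r p - {{i, p i}}"
    using Cons.prems by (auto simp: parent_edges_def)
  then have "(i, p i) \<notin> (adjacency ?E)\<^sup>*"
    using connected_mono parent_edge_is_bridge[OF p i(1,2)] by metis
  moreover have "(i, p i) \<in> (adjacency ?E)\<^sup>*" if "i \<in> orbit ?f (p i)"
    using that by (intro connected_sym[OF orbit_rev_product_connected]) auto
  ultimately have "i \<notin> orbit ?f (p i)"
    by blast
  note join = join_orbits[OF f this]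
  have g: "rev_product (map (\<lambda>i. transpose i (p i)) (i # is)) = ?f \<circ> transpose i (p i)"
    by simp
  have perm: "permutation (?f \<circ> transpose i (p i))"
    by (intro permutation_compose f permutation_swap_id)
  from Cons.prems(3) consider "(x, y) \<in> adjacency ?E" | "{x, y} = {i, p i}"
    by auto
  then show ?case
    unfolding g
  proof cases
    case 1
    then show "y \<in> orbit (?f \<circ> transpose i (p i)) x"
      using Cons.IH[of x y] Cons.prems by (intro join(2)) auto
  next
    case 2
    then show "y \<in> orbit (?f \<circ> transpose i (p i)) x"
      using join(1) orbit_commute[OF perm join(1)] by (auto simp: doubleton_eq_iff)
  qed
qed simp

text \<open>
  This is a classical observation of Denes: the transpositions along the edges of a tree, multiplied
  in any order, give a cycle through all vertices.
\<close>

lemma tree_product_cyclic: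
  assumes p: "rooted V r p" and "distinct is" "set is = V - {r}"
  defines "f \<equiv> rev_product (map (\<lambda>i. transpose i (p i)) is)"
  shows "f permutes V" "cyclic_on f V"
proof -
  show perm: "f permutes V"
    unfolding f_def
    using assms(3) rooted_parent_in[OF p] by (intro permutes_rev_product) (auto intro!: permutes_swap_id)
  have fin: "finite V" "r \<in> V"
    using p by (auto simp: rooted_def)
  then have permf: "permutation f"
    using perm by (auto simp: permutation_permutes)
  have "r \<in> orbit f v" if "v \<in> V" for v
    using rooted_connected[OF p that]
  proof (induction rule: converse_rtrancl_induct)
    case base
    then show ?case
      by (rule permutation_self_in_orbit[OF permf])
  next
    case (step x y)
    then have "y \<in> orbit f x"
      using connected_imp_orbit[OF p assms(2)] assms(3) by (simp add: f_def parent_edges_def)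
    then show ?case
      by (rule orbit_trans[OF step.IH])
  qed
  then have "V \<subseteq> orbit f r"
    using orbit_commute[OF permf] by blast
  then have "orbit f r = V"
    using permutes_orbit_subset[OF perm fin(2)] by blast
  then show "cyclic_on f V"
    using fin by (auto intro: cyclic_on_singleI)
qed

lemma cyclic_on_funpow_bij:
  assumes "cyclic_on f V" "r \<in> V"
  shows "bij_betw (\<lambda>k. (f ^^ k) r) {0..<card V} V" "(f ^^ card V) r = r"
proof -
  have V: "orbit f r = V"
    using assms by (rule orbit_cyclic_eq3)
  then have self: "r \<in> orbit f r"
    using assms(2) by simp
  let ?m = "funpow_dist1 f r r"
  have bij: "bij_betw (\<lambda>k. (f ^^ k) r) {0..<?m} V"
    using inj_on_funpow_dist1[OF self] orbit_conv_funpow_dist1[OF self] V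
    by (simp add: bij_betw_def)
  then have "card V = ?m"
    using bij_betw_same_card by fastforce
  then show "bij_betw (\<lambda>k. (f ^^ k) r) {0..<card V} V" "(f ^^ card V) r = r"
    using bij funpow_dist1_prop[OF self] by simp_all
qed

text \<open>
  The conjugator is determined by its value at \<open>r\<close>, because \<open>\<theta> (f x) = g (\<theta> x)\<close> propagates it along
  the cycle of \<open>f\<close>.
\<close>

lemma conjugator_unique:
  assumes f: "cyclic_on f V" "r \<in> V"
    and "\<theta> permutes V" "\<theta> r = r" "\<theta> \<circ> f = g \<circ> \<theta>"
    and "\<theta>' permutes V" "\<theta>' r = r" "\<theta>' \<circ> f = g \<circ> \<theta>'"
  shows "\<theta> = \<theta>'"
proof
  fix x
  show "\<theta> x = \<theta>' x"
  proof (cases "x \<in> V")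
    case True
    then have "x \<in> orbit f r"
      using orbit_cyclic_eq3[OF f] by simp
    then show ?thesis
      by induction (use assms(4,5,7,8) in \<open>metis comp_apply\<close>)+
  next
    case False
    then show ?thesis
      using assms(3,6) by (simp add: permutes_not_in)
  qed
qed

text \<open>
  The conjugator sends \<open>f\<^sup>k r\<close> to \<open>g\<^sup>k r\<close>. This is consistent because both cycles return to \<open>r\<close> after
  \<open>card V\<close> steps.
\<close>

lemma conjugator_exists:
  assumes f: "cyclic_on f V" "f permutes V" and g: "cyclic_on g V" "g permutes V" and r: "r \<in> V"
  obtains \<theta> where "\<theta> permutes V" "\<theta> r = r" "\<theta> \<circ> f = g \<circ> \<theta>"
proof -
  define m where "m = card V"
  define a where "a k = (f ^^ k) r" for k
  define b where "b k = (g ^^ k) r" for k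
  have a: "bij_betw a {0..<m} V" "a m = r" and b: "bij_betw b {0..<m} V" "b m = r"
    using cyclic_on_funpow_bij[OF f(1) r] cyclic_on_funpow_bij[OF g(1) r]
    by (simp_all add: a_def[abs_def] b_def[abs_def] m_def)
  define \<theta> where "\<theta> x = (if x \<in> V then b (inv_into {0..<m} a x) else x)" for x
  have \<theta>a: "\<theta> (a k) = b k" if "k < m" for k
    using that a(1) bij_betwE[OF a(1)] by (auto simp: \<theta>_def bij_betw_inv_into_left)
  have "m \<noteq> 0"
    using r a(1) by (auto simp: bij_betw_def)
  then have \<theta>r: "\<theta> r = r"
    using \<theta>a[of 0] by (simp add: a_def b_def)
  have "bij_betw (b \<circ> inv_into {0..<m} a) V V"
    by (rule bij_betw_trans[OF bij_betw_inv_into[OF a(1)] b(1)])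
  then have "bij_betw \<theta> V V"
    by (rule bij_betw_cong[THEN iffD1, rotated]) (simp add: \<theta>_def)
  then have perm: "\<theta> permutes V"
    by (rule bij_imp_permutes) (simp add: \<theta>_def)
  have "\<theta> (f x) = g (\<theta> x)" for x
  proof (cases "x \<in> V")
    case True
    then obtain k where k: "k < m" "x = a k"
      using a(1) by (auto simp: bij_betw_def)
    have "f x = a (Suc k)" "g (b k) = b (Suc k)"
      by (simp_all add: k a_def b_def)
    moreover have "\<theta> (a (Suc k)) = b (Suc k)"
      using k \<theta>a[of "Suc k"] a(2) b(2) \<theta>r by (cases "Suc k = m") auto
    ultimately show ?thesis
      using \<theta>a k by simp
  next
    case False
    then show ?thesis
      using f(2) g(2) by (simp add: \<theta>_def permutes_not_in)
  qed
  then have "\<theta> \<circ> f = g \<circ> \<theta>"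
    by auto
  with perm \<theta>r show thesis
    by (rule that)
qed

lemma full_cycle_permutes: "full_cycle n permutes {1..n}"
  using cycle_permutes[of "[1..<Suc n]"]
  by (simp add: full_cycle_def atLeastLessThanSuc_atLeastAtMost del: upt_Suc)

lemma full_cycle_cyclic:
  assumes "n \<ge> 1"
  shows "cyclic_on (full_cycle n) {1..n}"
proof -
  have "k \<in> orbit (full_cycle n) n" if "1 \<le> k" "k \<le> n" for k
    using that
  proof (induction k rule: dec_induct)
    case base
    then show ?case
      using orbit.base[of "full_cycle n" n] assms by (simp add: full_cycle_apply)
  next
    case (step k)
    then show ?case
      using orbit.step[of k "full_cycle n" n] by (simp add: full_cycle_apply)
  qed
  then have "orbit (full_cycle n) n = {1..n}"
    using permutes_orbit_subset[OF full_cycle_permutes, of n n] assms by auto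
  then show ?thesis
    using assms by (intro cyclic_on_singleI[of n]) auto
qed

text \<open>
  Multiplying the full cycle by a transposition cuts it into two cycles, one through
  \<open>s, \<dots>, t - 1\<close> and one through the other points. Their lengths are the two numbers in the
  difference index.
\<close>

lemma split_full_cycle:
  assumes st: "1 \<le> s" "s < t" "t \<le> n"
  defines "P \<equiv> transpose s t \<circ> full_cycle n"
  shows "x \<in> {s..<t} \<Longrightarrow> y \<in> {s..<t} \<Longrightarrow> y \<in> orbit P x"
    and "x \<in> {1..n} - {s..<t} \<Longrightarrow> y \<in> {1..n} - {s..<t} \<Longrightarrow> y \<in> orbit P x"
proof -
  have "P permutes {1..n}"
    unfolding P_def using st by (intro permutes_compose full_cycle_permutes permutes_swap_id) auto
  then have perm: "permutation P"
    by (auto simp: permutation_permutes)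
  have Suc: "P k = Suc k" if "1 \<le> k" "k < n" "Suc k \<noteq> s" "Suc k \<noteq> t" for k
    using that by (simp add: P_def full_cycle_apply)
  have Pn: "P n = (if s = 1 then t else 1)"
    using st by (simp add: P_def full_cycle_apply)
  have inner: "k \<in> orbit P s" if "s \<le> k" "k < t" for k
    using that
  proof (induction k rule: dec_induct)
    case (step k)
    then show ?case
      using orbit.step[of k P s] Suc[of k] st by simp
  qed (rule permutation_self_in_orbit[OF perm])
  have upper: "k \<in> orbit P t" if "t \<le> k" "k \<le> n" for k
    using that
  proof (induction k rule: dec_induct)
    case (step k)
    then show ?case
      using orbit.step[of k P t] Suc[of k] st by simp
  qed (rule permutation_self_in_orbit[OF perm])
  have lower: "k \<in> orbit P t" if "1 \<le> k" "k < s" for k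
    using that
  proof (induction k rule: dec_induct)
    case base
    then show ?case
      using orbit.step[of n P t] upper[of n] Pn st by simp
  next
    case (step k)
    then show ?case
      using orbit.step[of k P t] Suc[of k] st by simp
  qed
  have via: "y \<in> orbit P x" if "x \<in> orbit P z" "y \<in> orbit P z" for x y z
    using that(2) orbit_commute[OF perm that(1)] by (rule orbit_trans)
  show "y \<in> orbit P x" if "x \<in> {s..<t}" "y \<in> {s..<t}"
    using that by (auto intro!: via[of x s y] inner)
  show "y \<in> orbit P x" if "x \<in> {1..n} - {s..<t}" "y \<in> {1..n} - {s..<t}"
  proof -
    have "z \<in> orbit P t" if "z \<in> {1..n} - {s..<t}" for z
      using that upper[of z] lower[of z] by force
    with that show ?thesis
      by (intro via[of x t y])
  qed
qed

section \<open>Dual factorizations\<close>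
lemma transposition_iff:
  "\<sigma> \<in> transpositions n \<longleftrightarrow> (\<exists>s t. s \<in> {1..n} \<and> t \<in> {1..n} \<and> s \<noteq> t \<and> \<sigma> = transpose s t)"
  unfolding transpositions_def by (auto; metis transpose_commute nat_neq_iff)

lemma transposition_permutes: "\<sigma> \<in> transpositions n \<Longrightarrow> \<sigma> permutes {1..n}"
  by (auto simp: transposition_iff permutes_swap_id)

lemma transposition_involution: "\<sigma> \<in> transpositions n \<Longrightarrow> \<sigma> \<circ> \<sigma> = id"
  by (auto simp: transposition_iff)

lemma conjugate_transpose: "bij \<theta> \<Longrightarrow> \<theta> \<circ> transpose a b = transpose (\<theta> a) (\<theta> b) \<circ> \<theta>"
  by (simp add: transpose_comp_eq bij_is_inj inv_f_f)

lemma conjugate_transposition: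
  assumes P: "P permutes {1..n}" and \<sigma>: "\<sigma> \<in> transpositions n"
  shows "inv P \<circ> \<sigma> \<circ> P \<in> transpositions n"
proof -
  obtain s t where st: "s \<in> {1..n}" "t \<in> {1..n}" "s \<noteq> t" "\<sigma> = transpose s t"
    using \<sigma> by (auto simp: transposition_iff)
  have "inv P \<circ> \<sigma> \<circ> P = transpose (inv P s) (inv P t) \<circ> (inv P \<circ> P)"
    using conjugate_transpose[OF permutes_bij[OF permutes_inv[OF P]], of s t] st(4)
    by (simp add: comp_assoc[symmetric])
  also have "\<dots> = transpose (inv P s) (inv P t)"
    by (simp add: permutes_inv_o[OF P])
  finally show ?thesis
    using st(1-3) permutes_in_image[OF permutes_inv[OF P]] permutes_inj[OF permutes_inv[OF P]]
    unfolding transposition_iff by (metis injD)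
qed

definition product_of :: "('a \<Rightarrow> 'a) list \<Rightarrow> 'a \<Rightarrow> 'a" where
  "product_of F = foldr (\<circ>) F id"

lemma product_of_simps [simp]:
  "product_of [] = id" "product_of (\<sigma> # F) = \<sigma> \<circ> product_of F"
  by (simp_all add: product_of_def)

lemma factorizations_altdef:
  "factorizations n = {F. length F = n - 1 \<and> set F \<subseteq> transpositions n \<and> product_of F = full_cycle n}"
  by (simp add: factorizations_def product_of_def)

text \<open>
  The factor \<open>\<sigma>\<^sub>i\<close> becomes \<open>\<rho>\<^sub>i = V\<^sup>-\<^sup>1 \<sigma>\<^sub>i V\<close>, where \<open>V\<close> is the product of the factors on its right. If the
  factors are drawn as chords between points on a circle, \<open>\<rho>\<^sub>i\<close> joins the two arcs whose regions lie on
  either side of the chord \<open>\<sigma>\<^sub>i\<close>, the arc from \<open>k\<close> to \<open>k + 1\<close> being named \<open>k\<close>: it exchanges the two points that arrive at the ends of \<open>\<sigma>\<^sub>i\<close> at the moment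
  when \<open>\<sigma>\<^sub>i\<close> acts.
\<close>

fun hurwitz_dual :: "('a \<Rightarrow> 'a) list \<Rightarrow> ('a \<Rightarrow> 'a) list" where
  "hurwitz_dual [] = []"
| "hurwitz_dual (\<sigma> # F) = (inv (product_of F) \<circ> \<sigma> \<circ> product_of F) # hurwitz_dual F"

text \<open>
  The inverse operation. The product of the \<open>\<rho>\<close> to the right of an entry, taken in the opposite order,
  is the product of the original factors there, so the conjugation can be undone.
\<close>

fun hurwitz_codual :: "('a \<Rightarrow> 'a) list \<Rightarrow> ('a \<Rightarrow> 'a) list" where
  "hurwitz_codual [] = []"
| "hurwitz_codual (\<rho> # R) = (rev_product R \<circ> \<rho> \<circ> inv (rev_product R)) # hurwitz_codual R"

lemma length_hurwitz_dual [simp]: "length (hurwitz_dual F) = length F"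
  by (induction F) auto

lemma length_hurwitz_codual [simp]: "length (hurwitz_codual R) = length R"
  by (induction R) auto

lemma permutes_product_of: "(\<And>\<sigma>. \<sigma> \<in> set F \<Longrightarrow> \<sigma> permutes V) \<Longrightarrow> product_of F permutes V"
proof (induction F)
  case (Cons \<sigma> F)
  then have "\<sigma> permutes V" "product_of F permutes V"
    by simp_all
  then show ?case
    unfolding product_of_simps by (intro permutes_compose)
qed (simp add: permutes_id)

lemma transpositions_product_of_permutes:
  "set F \<subseteq> transpositions n \<Longrightarrow> product_of F permutes {1..n}"
  by (rule permutes_product_of) (use transposition_permutes in blast)

lemma transpositions_rev_product_permutes:
  "set F \<subseteq> transpositions n \<Longrightarrow> rev_product F permutes {1..n}"
  by (rule permutes_rev_product) (use transposition_permutes in blast)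

lemma hurwitz_dual_transpositions:
  "set F \<subseteq> transpositions n \<Longrightarrow> set (hurwitz_dual F) \<subseteq> transpositions n"
proof (induction F)
  case (Cons \<sigma> F)
  then show ?case
    using conjugate_transposition[OF transpositions_product_of_permutes, of F n \<sigma>] by simp
qed simp

lemma hurwitz_codual_transpositions:
  "set R \<subseteq> transpositions n \<Longrightarrow> set (hurwitz_codual R) \<subseteq> transpositions n"
proof (induction R)
  case (Cons \<rho> R)
  then have P: "rev_product R permutes {1..n}"
    by (intro transpositions_rev_product_permutes) simp
  show ?case
    using conjugate_transposition[OF permutes_inv[OF P], of \<rho>] Cons
    by (simp add: permutes_inv_inv[OF P])
qed simp

lemma rev_product_hurwitz_dual:
  assumes "set F \<subseteq> transpositions n"
  shows "rev_product (hurwitz_dual F) = product_of F"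
  using assms
proof (induction F)
  case (Cons \<sigma> F)
  have P: "product_of F permutes {1..n}"
    using Cons.prems by (intro transpositions_product_of_permutes) simp
  have "product_of F \<circ> (inv (product_of F) \<circ> \<sigma> \<circ> product_of F) = \<sigma> \<circ> product_of F"
    by (rule ext) (simp only: comp_apply permutes_inverses[OF P])
  then show ?case
    using Cons by simp
qed simp

lemma product_of_hurwitz_codual:
  assumes "set R \<subseteq> transpositions n"
  shows "product_of (hurwitz_codual R) = rev_product R"
  using assms
proof (induction R)
  case (Cons \<rho> R)
  have P: "rev_product R permutes {1..n}"
    using Cons.prems by (intro transpositions_rev_product_permutes) simp
  have "rev_product R \<circ> \<rho> \<circ> inv (rev_product R) \<circ> rev_product R = rev_product R \<circ> \<rho>"
    by (rule ext) (simp only: comp_apply permutes_inverses[OF P])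
  then show ?case
    using Cons by simp
qed simp

lemma hurwitz_codual_dual:
  assumes "set F \<subseteq> transpositions n"
  shows "hurwitz_codual (hurwitz_dual F) = F"
  using assms
proof (induction F)
  case (Cons \<sigma> F)
  let ?P = "product_of F"
  have P: "?P permutes {1..n}"
    using Cons.prems by (intro transpositions_product_of_permutes) simp
  have "?P \<circ> (inv ?P \<circ> \<sigma> \<circ> ?P) \<circ> inv ?P = \<sigma>"
    by (rule ext) (simp only: comp_apply permutes_inverses[OF P])
  moreover have "rev_product (hurwitz_dual F) = ?P"
    using Cons.prems by (intro rev_product_hurwitz_dual[of _ n]) simp
  ultimately show ?case
    using Cons by simp
qed simp

lemma hurwitz_dual_codual:
  assumes "set R \<subseteq> transpositions n"
  shows "hurwitz_dual (hurwitz_codual R) = R"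
  using assms
proof (induction R)
  case (Cons \<rho> R)
  let ?P = "rev_product R"
  have P: "?P permutes {1..n}"
    using Cons.prems by (intro transpositions_rev_product_permutes) simp
  have "inv ?P \<circ> (?P \<circ> \<rho> \<circ> inv ?P) \<circ> ?P = \<rho>"
    by (rule ext) (simp only: comp_apply permutes_inverses[OF P])
  moreover have "product_of (hurwitz_codual R) = ?P"
    using Cons.prems by (intro product_of_hurwitz_codual[of _ n]) simp
  ultimately show ?case
    using Cons by simp
qed simp

text \<open>
  This is why duality turns differences into component sizes. Let \<open>P\<close> be the product of the factors to
  the right of \<open>\<sigma>\<close>, so that \<open>rev_product X = P\<close> and \<open>\<rho> = P\<^sup>-\<^sup>1 \<sigma> P\<close>. The full product is
  \<open>P \<rho> Z = \<sigma> P Z\<close> with \<open>Z = rev_product Y\<close>, and multiplying by the involution \<open>\<sigma>\<close> leaves \<open>P Z\<close>.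
\<close>

lemma hurwitz_dual_delete:
  assumes "set F \<subseteq> transpositions n" "hurwitz_dual F = Y @ \<rho> # X"
  shows "rev_product (Y @ X) = F ! length Y \<circ> product_of F"
  using assms
proof (induction Y arbitrary: F)
  case Nil
  then obtain \<sigma> F' where F: "F = \<sigma> # F'" "X = hurwitz_dual F'"
    by (cases F) auto
  then have "rev_product X = product_of F'"
    using Nil.prems by (auto intro: rev_product_hurwitz_dual)
  moreover have "\<sigma> \<circ> (\<sigma> \<circ> product_of F') = product_of F'"
    using Nil.prems F transposition_involution[of \<sigma> n] by (simp add: o_assoc)
  ultimately show ?case
    unfolding F by (simp only: append_Nil list.size nth_Cons_0 product_of_simps)
next
  case (Cons y Y)
  then obtain \<sigma> F' where F: "F = \<sigma> # F'" "hurwitz_dual F' = Y @ \<rho> # X"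
      and y: "y = inv (product_of F') \<circ> \<sigma> \<circ> product_of F'"
    by (cases F) auto
  have P: "product_of F' permutes {1..n}"
    using Cons.prems F by (intro transpositions_product_of_permutes) simp
  have "rev_product (Y @ X) = F' ! length Y \<circ> product_of F'"
    using Cons F by auto
  moreover have "F' ! length Y \<circ> product_of F' \<circ> y = F' ! length Y \<circ> (\<sigma> \<circ> product_of F')"
    unfolding y by (rule ext) (simp only: comp_apply permutes_inverses[OF P])
  ultimately show ?case
    by (simp add: F)
qed

section \<open>The tree of a factorization\<close>

definition moved :: "('a \<Rightarrow> 'a) \<Rightarrow> 'a set" where
  "moved \<tau> = {x. \<tau> x \<noteq> x}"

lemma moved_transpose: "a \<noteq> b \<Longrightarrow> moved (transpose a b) = {a, b}"
  by (auto simp: moved_def transpose_def)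

lemma transposition_eq_transpose:
  assumes "\<tau> \<in> transpositions n" "moved \<tau> = {a, b}"
  shows "\<tau> = transpose a b"
  using assms by (auto simp: transposition_iff moved_transpose doubleton_eq_iff transpose_commute)

text \<open>
  The dual transpositions of \<open>F\<close> are the edges of a tree on \<open>{1..n}\<close>, numbered by \<open>{1..<n}\<close> and rooted
  at \<open>n\<close>. The numbering is moved from each edge to its lower end: \<open>\<theta> i\<close> is the vertex whose parent
  edge is the \<open>i\<close>-th one, and the root keeps the label \<open>n\<close>. Then \<open>p\<close> is the parent function of the
  relabelled tree.
\<close>

definition dual_tree :: "nat \<Rightarrow> (nat \<Rightarrow> nat) list \<Rightarrow> (nat \<Rightarrow> nat) \<Rightarrow> (nat \<Rightarrow> nat) \<Rightarrow> bool" where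
  "dual_tree n F \<theta> p \<longleftrightarrow> rooted {1..n} n p \<and> \<theta> permutes {1..n} \<and> \<theta> n = n \<and>
     hurwitz_dual F = map (\<lambda>i. transpose (\<theta> i) (\<theta> (p i))) [1..<n]"

lemma rooted_relabel:
  assumes q: "rooted V r q" and \<theta>: "\<theta> permutes V" "\<theta> r = r"
  shows "rooted V r (inv \<theta> \<circ> q \<circ> \<theta>)"
proof -
  obtain d :: "'a \<Rightarrow> nat" where d: "finite V" "r \<in> V" "\<And>v. v \<in> V \<Longrightarrow> v \<noteq> r \<Longrightarrow> q v \<in> V"
    "\<And>v. v \<in> V \<Longrightarrow> v \<noteq> r \<Longrightarrow> d (q v) < d v"
    using rootedE[OF q] by metis
  have "\<theta> v \<in> V" "\<theta> v \<noteq> r" if "v \<in> V - {r}" for v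
    using that permutes_in_image[OF \<theta>(1)] \<theta>(2) permutes_inj[OF \<theta>(1)] by (auto simp: inj_def)
  then have "\<forall>v\<in>V - {r}. (inv \<theta> \<circ> q \<circ> \<theta>) v \<in> V \<and> (d \<circ> \<theta>) ((inv \<theta> \<circ> q \<circ> \<theta>) v) < (d \<circ> \<theta>) v"
    using d by (simp add: permutes_inverses[OF \<theta>(1)] permutes_in_image[OF permutes_inv[OF \<theta>(1)]])
  then show ?thesis
    using d(1,2) unfolding rooted_def by blast
qed

text \<open>
  The edges of the dual transpositions connect all vertices, because their product is the full
  cycle. There are at most \<open>n - 1\<close> of them, which is the size of a spanning tree, so they are exactly
  the parent edges of a rooted tree and no edge is repeated. Matching the \<open>i\<close>-th edge with the vertex
  below it gives \<open>\<theta>\<close>.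
\<close>

lemma dual_tree_exists:
  assumes n: "n \<ge> 1" and F: "F \<in> factorizations n"
  obtains p \<theta> where "dual_tree n F \<theta> p"
proof -
  let ?V = "{1..n}"
  define R where "R = hurwitz_dual F"
  have R: "length R = n - 1" "set R \<subseteq> transpositions n" "rev_product R = full_cycle n"
    using F by (auto simp: factorizations_altdef R_def hurwitz_dual_transpositions rev_product_hurwitz_dual)
  have V: "?V - {n} = {1..<n}"
    by auto
  define e where "e i = moved (R ! (i - 1))" for i
  define E where "E = e ` {1..<n}"
  have e_R: "R ! (i - 1) \<in> transpositions n" if "i \<in> {1..<n}" for i
    using R(1,2) that nth_mem[of "i - 1" R] by auto
  have e_in: "\<exists>a b. a \<in> ?V \<and> b \<in> ?V \<and> a \<noteq> b \<and> e i = {a, b}" if "i \<in> {1..<n}" for i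
    using e_R[OF that] unfolding e_def transposition_iff by (metis moved_transpose)
  have R_edge: "\<exists>i j. r = transpose i j \<and> {i, j} \<in> E" if "r \<in> set R" for r
  proof -
    obtain k where k: "k < n - 1" "r = R ! k"
      using \<open>r \<in> set R\<close> R(1) by (auto simp: in_set_conv_nth)
    then have "Suc k \<in> {1..<n}"
      by auto
    then have "e (Suc k) \<in> E" "r \<in> transpositions n"
      using R(2) that by (auto simp: E_def)
    moreover obtain a b where "e (Suc k) = {a, b}"
      using e_in[OF \<open>Suc k \<in> {1..<n}\<close>] by blast
    ultimately show ?thesis
      using transposition_eq_transpose[of r n a b] k by (auto simp: e_def)
  qed
  have conn: "(v, n) \<in> (adjacency E)\<^sup>*" if "v \<in> ?V" for v
  proof -
    have "n \<in> orbit (rev_product R) v"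
      using orbit_cyclic_eq3[OF full_cycle_cyclic[OF n] that] n by (simp add: R(3))
    then show ?thesis
      using R_edge by (rule orbit_rev_product_connected[rotated])
  qed
  have E_sub: "e \<subseteq> ?V" if "e \<in> E" for e
    using that e_in by (fastforce simp: E_def)
  have "n \<in> ?V"
    using n by simp
  from connected_imp_parents[OF _ this E_sub conn]
  obtain q where q: "rooted ?V n q" "parent_edges ?V n q \<subseteq> E"
    by blast
  have "card E \<le> n - 1"
    using card_image_le[of "{1..<n}" e] by (simp add: E_def)
  moreover have card_q: "card (parent_edges ?V n q) = n - 1"
    using card_parent_edges[OF q(1)] by simp
  ultimately have E: "parent_edges ?V n q = E"
    using card_seteq[OF _ q(2)] by (simp add: E_def)
  define g where "g v = {v, q v}" for v
  have g: "bij_betw g {1..<n} E"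
    using inj_on_parent_edge[OF q(1)] unfolding E[symmetric] g_def[abs_def] parent_edges_def V
    by (rule bij_betw_imageI) simp
  have "inj_on e {1..<n}"
    using card_q E by (intro eq_card_imp_inj_on) (simp_all add: E_def)
  then have e: "bij_betw e {1..<n} E"
    by (simp add: bij_betw_def E_def)
  define \<theta> where "\<theta> i = (if i \<in> {1..<n} then inv_into {1..<n} g (e i) else i)" for i
  have "bij_betw (inv_into {1..<n} g \<circ> e) {1..<n} {1..<n}"
    by (rule bij_betw_trans[OF e bij_betw_inv_into[OF g]])
  then have "bij_betw \<theta> {1..<n} {1..<n}"
    by (rule bij_betw_cong[THEN iffD1, rotated]) (simp add: \<theta>_def)
  then have "\<theta> permutes {1..<n}"
    by (rule bij_imp_permutes) (simp only: \<theta>_def if_False)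
  then have \<theta>: "\<theta> permutes ?V"
    by (rule permutes_subset) auto
  have \<theta>n: "\<theta> n = n"
    by (simp add: \<theta>_def)
  define p where "p = inv \<theta> \<circ> q \<circ> \<theta>"
  have p: "rooted ?V n p"
    unfolding p_def by (rule rooted_relabel[OF q(1) \<theta> \<theta>n])
  have "R ! (i - 1) = transpose (\<theta> i) (\<theta> (p i))" if "i \<in> {1..<n}" for i
  proof -
    have "e i \<in> E"
      using that by (simp add: E_def)
    then have "g (\<theta> i) = e i"
      using that bij_betw_inv_into_right[OF g] by (simp add: \<theta>_def)
    then have "moved (R ! (i - 1)) = {\<theta> i, \<theta> (p i)}"
      by (simp add: e_def g_def p_def permutes_inverses[OF \<theta>])
    then show ?thesis
      by (rule transposition_eq_transpose[OF e_R[OF that]])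
  qed
  then have "R ! k = transpose (\<theta> (Suc k)) (\<theta> (p (Suc k)))" if "k < n - 1" for k
    using that by (metis Suc_eq_plus1 Suc_leI atLeastLessThan_iff diff_Suc_1 less_diff_conv zero_less_Suc One_nat_def)
  then have "R = map (\<lambda>i. transpose (\<theta> i) (\<theta> (p i))) [1..<n]"
    using R(1) by (intro nth_equalityI) auto
  with p \<theta> \<theta>n show thesis
    by (intro that[of \<theta> p]) (simp add: dual_tree_def R_def)
qed

lemma rev_product_relabel:
  assumes "bij \<theta>"
  shows "\<theta> \<circ> rev_product (map (\<lambda>i. transpose i (p i)) is) =
    rev_product (map (\<lambda>i. transpose (\<theta> i) (\<theta> (p i))) is) \<circ> \<theta>"
proof (induction "is")
  case (Cons i "is")
  then show ?case
    by (simp only: list.map rev_product.simps o_assoc)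
      (simp only: comp_assoc conjugate_transpose[OF assms])
qed simp

text \<open>
  The product of the transpositions along the edges of the given tree is a cycle of length \<open>n\<close>.
  The relabelling \<open>\<theta>\<close> that turns this cycle into the full cycle makes these transpositions the dual of
  a factorization.
\<close>

lemma dual_factorization_exists:
  assumes n: "n \<ge> 1" and p: "rooted {1..n} n p"
  obtains F \<theta> where "F \<in> factorizations n" "dual_tree n F \<theta> p"
proof -
  let ?Q = "rev_product (map (\<lambda>i. transpose i (p i)) [1..<n])"
  have "set [1..<n] = {1..n} - {n}"
    by auto
  note Q = tree_product_cyclic[OF p distinct_upt this]
  obtain \<theta> where \<theta>: "\<theta> permutes {1..n}" "\<theta> n = n" "\<theta> \<circ> ?Q = full_cycle n \<circ> \<theta>"
    using conjugator_exists[OF Q(2,1) full_cycle_cyclic[OF n] full_cycle_permutes, of n] n by auto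
  define R where "R = map (\<lambda>i. transpose (\<theta> i) (\<theta> (p i))) [1..<n]"
  have "transpose (\<theta> i) (\<theta> (p i)) \<in> transpositions n" if "i \<in> {1..<n}" for i
  proof -
    have i: "i \<in> {1..n}" "p i \<in> {1..n}" "p i \<noteq> i"
      using that rooted_parent_in[OF p, of i] rooted_parent_neq[OF p, of i] by auto
    then have "\<theta> i \<in> {1..n}" "\<theta> (p i) \<in> {1..n}" "\<theta> i \<noteq> \<theta> (p i)"
      using permutes_in_image[OF \<theta>(1)] inj_eq[OF permutes_inj[OF \<theta>(1)]] by simp_all
    then show ?thesis
      unfolding transposition_iff by blast
  qed
  then have R: "set R \<subseteq> transpositions n"
    by (auto simp: R_def)
  have "rev_product R \<circ> \<theta> = full_cycle n \<circ> \<theta>"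
    using rev_product_relabel[OF permutes_bij[OF \<theta>(1)], of p "[1..<n]"] \<theta>(3) by (simp add: R_def)
  then have "rev_product R = full_cycle n"
    using permutes_surj[OF \<theta>(1)] by (metis surj_fun_eq)
  then have "hurwitz_codual R \<in> factorizations n"
    using R by (simp add: factorizations_altdef hurwitz_codual_transpositions product_of_hurwitz_codual R_def)
  moreover have "dual_tree n (hurwitz_codual R) \<theta> p"
    using p \<theta> hurwitz_dual_codual[OF R] by (simp add: dual_tree_def R_def)
  ultimately show thesis
    by (rule that)
qed

text \<open>
  After relabelling by \<open>\<theta>\<close> and \<open>\<theta>'\<close>, both trees have the dual transpositions of \<open>F\<close> as their edges.
  They therefore have the same parent function, and the vertices below the \<open>i\<close>-th edge, \<open>\<theta> i\<close> and \<open>\<theta>' i\<close>,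
  coincide.
\<close>

lemma dual_tree_unique:
  assumes "dual_tree n F \<theta> p" "dual_tree n F \<theta>' p'"
  shows "parent_edges {1..n} n p = parent_edges {1..n} n p'"
proof -
  let ?V = "{1..n}"
  have p: "rooted ?V n p" and \<theta>: "\<theta> permutes ?V" "\<theta> n = n"
    and p': "rooted ?V n p'" and \<theta>': "\<theta>' permutes ?V" "\<theta>' n = n"
    using assms by (auto simp: dual_tree_def)
  have "map (\<lambda>i. transpose (\<theta> i) (\<theta> (p i))) [1..<n] = map (\<lambda>i. transpose (\<theta>' i) (\<theta>' (p' i))) [1..<n]"
    using assms by (simp add: dual_tree_def)
  then have "transpose (\<theta> i) (\<theta> (p i)) = transpose (\<theta>' i) (\<theta>' (p' i))" if "i \<in> {1..<n}" for i
    using that by simp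
  moreover have "\<theta> i \<noteq> \<theta> (p i)" "\<theta>' i \<noteq> \<theta>' (p' i)" if "i \<in> {1..<n}" for i
    using that rooted_parent_neq[OF p, of i] rooted_parent_neq[OF p', of i]
      permutes_inj[OF \<theta>(1)] permutes_inj[OF \<theta>'(1)] by (auto simp: inj_eq)
  ultimately have edge: "{\<theta> i, \<theta> (p i)} = {\<theta>' i, \<theta>' (p' i)}" if "i \<in> {1..<n}" for i
    using that moved_transpose[of "\<theta> i" "\<theta> (p i)"] moved_transpose[of "\<theta>' i" "\<theta>' (p' i)"] by simp
  \<comment> \<open>The parent functions of the two trees, carried over to the vertices of the dual tree.\<close>
  define q where "q = inv (inv \<theta>) \<circ> p \<circ> inv \<theta>"
  define q' where "q' = inv (inv \<theta>') \<circ> p' \<circ> inv \<theta>'"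
  have q: "rooted ?V n q"
    unfolding q_def using rooted_relabel[OF p permutes_inv[OF \<theta>(1)]] \<theta> by (simp add: permutes_inv_eq)
  have q': "rooted ?V n q'"
    unfolding q'_def using rooted_relabel[OF p' permutes_inv[OF \<theta>'(1)]] \<theta>' by (simp add: permutes_inv_eq)
  have V: "?V - {n} = {1..<n}"
    by auto
  have q_\<theta>: "q (\<theta> i) = \<theta> (p i)" and q'_\<theta>': "q' (\<theta>' i) = \<theta>' (p' i)" for i
    by (simp_all add: q_def q'_def permutes_inverses[OF \<theta>(1)] permutes_inverses[OF \<theta>'(1)]
        permutes_inv_inv[OF \<theta>(1)] permutes_inv_inv[OF \<theta>'(1)])
  have im: "\<pi> ` {1..<n} = {1..<n}" if "\<pi> permutes ?V" "\<pi> n = n" for \<pi>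
    using permutes_image[OF that(1)] that(2) inj_on_image_set_diff[OF permutes_inj[OF that(1)], of ?V "{n}"]
    unfolding V[symmetric] by simp
  have "parent_edges ?V n q = (\<lambda>v. {v, q v}) ` \<theta> ` {1..<n}"
    by (simp only: parent_edges_def V im[OF \<theta>])
  also have "\<dots> = (\<lambda>i. {\<theta> i, \<theta> (p i)}) ` {1..<n}"
    by (simp add: image_image q_\<theta>)
  also have "\<dots> = (\<lambda>i. {\<theta>' i, \<theta>' (p' i)}) ` {1..<n}"
    using edge by (intro image_cong) simp_all
  also have "\<dots> = (\<lambda>v. {v, q' v}) ` \<theta>' ` {1..<n}"
    by (simp add: image_image q'_\<theta>')
  also have "\<dots> = parent_edges ?V n q'"
    by (simp only: parent_edges_def V im[OF \<theta>'])
  finally have qq': "q v = q' v" if "v \<in> {1..<n}" for v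
    using parents_unique[OF q q'] that by auto
  have \<theta>\<theta>': "\<theta> i = \<theta>' i" if "i \<in> {1..<n}" for i
  proof (rule inj_onD[OF inj_on_parent_edge[OF q]])
    show "\<theta> i \<in> ?V - {n}" "\<theta>' i \<in> ?V - {n}"
      using im[OF \<theta>] im[OF \<theta>'] that unfolding V by blast+
    then show "{\<theta> i, q (\<theta> i)} = {\<theta>' i, q (\<theta>' i)}"
      using edge[OF that] qq'[of "\<theta>' i"] V by (simp add: q_\<theta> q'_\<theta>')
  qed
  have "p i = p' i" if "i \<in> {1..<n}" for i
  proof -
    have "\<theta> i \<in> {1..<n}"
      using im[OF \<theta>] that by blast
    then have "\<theta> (p i) = \<theta>' (p' i)"
      using q_\<theta>[of i] q'_\<theta>'[of i] \<theta>\<theta>'[OF that] qq' by simp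
    moreover have "\<theta> (p' i) = \<theta>' (p' i)"
      using rooted_parent_in[OF p', of i] that \<theta>\<theta>'[of "p' i"] \<theta>(2) \<theta>'(2) by (cases "p' i = n") auto
    ultimately show ?thesis
      using permutes_inj[OF \<theta>(1)] by (metis injD)
  qed
  then show ?thesis
    unfolding parent_edges_def V by (intro image_cong) simp_all
qed

text \<open>
  Both \<open>\<theta>\<close> and \<open>\<theta>'\<close> conjugate the product along the edges of the tree to the full cycle and fix \<open>n\<close>,
  so they are equal. Hence the two factorizations have the same dual.
\<close>

lemma dual_factorization_unique:
  assumes n: "n \<ge> 1" and F: "F \<in> factorizations n" "F' \<in> factorizations n"
    and dual: "dual_tree n F \<theta> p" "dual_tree n F' \<theta>' p'"
    and eq: "parent_edges {1..n} n p = parent_edges {1..n} n p'"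
  shows "F = F'"
proof -
  let ?V = "{1..n}"
  let ?Q = "\<lambda>p. rev_product (map (\<lambda>i. transpose i (p i)) [1..<n])"
  have p: "rooted ?V n p" and \<theta>: "\<theta> permutes ?V" "\<theta> n = n"
    and p': "rooted ?V n p'" and \<theta>': "\<theta>' permutes ?V" "\<theta>' n = n"
    using dual by (auto simp: dual_tree_def)
  have pp': "p i = p' i" if "i \<in> {1..<n}" for i
    using parents_unique[OF p p' eq, of i] that by simp
  have FT: "set F \<subseteq> transpositions n" "set F' \<subseteq> transpositions n"
    and C: "product_of F = full_cycle n" "product_of F' = full_cycle n"
    using F by (auto simp: factorizations_altdef)
  have conj: "\<theta> \<circ> ?Q p = full_cycle n \<circ> \<theta>"
    using rev_product_relabel[OF permutes_bij[OF \<theta>(1)], of p "[1..<n]"] dual(1)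
      rev_product_hurwitz_dual[OF FT(1)] C(1) by (simp add: dual_tree_def)
  have "\<theta>' \<circ> ?Q p' = full_cycle n \<circ> \<theta>'"
    using rev_product_relabel[OF permutes_bij[OF \<theta>'(1)], of p' "[1..<n]"] dual(2)
      rev_product_hurwitz_dual[OF FT(2)] C(2) by (simp add: dual_tree_def)
  moreover have QQ: "?Q p' = ?Q p"
    using pp' by (intro arg_cong[of _ _ rev_product] map_cong) simp_all
  ultimately have conj': "\<theta>' \<circ> ?Q p = full_cycle n \<circ> \<theta>'"
    by simp
  have "set [1..<n] = ?V - {n}"
    by auto
  from tree_product_cyclic(2)[OF p distinct_upt this]
  have "\<theta> = \<theta>'"
    by (rule conjugator_unique[OF _ _ \<theta> conj \<theta>' conj']) (use n in simp)
  then have "hurwitz_dual F = hurwitz_dual F'"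
    using dual pp' by (simp add: dual_tree_def)
  then show ?thesis
    using hurwitz_codual_dual[OF FT(1)] hurwitz_codual_dual[OF FT(2)] by metis
qed

text \<open>
  The product of the other dual transpositions is \<open>\<sigma>\<^sub>i\<close> times the full cycle, where \<open>\<sigma>\<^sub>i\<close> exchanges \<open>s\<close>
  and \<open>t\<close>. Its orbits are \<open>{s..<t}\<close> and the complement, and each of them is connected
  by the edges that remain. Deleting the edge disconnects the tree, so these two orbits are the
  components.
\<close>

lemma edge_deletion_index_dual:
  assumes F: "F \<in> factorizations n" and dual: "dual_tree n F \<theta> p" and i: "i \<in> {1..<n}"
  shows "edge_deletion_index n (parent_edges {1..n} n p) {i, p i} = difference_index n (F ! (i - 1))"
proof -
  let ?V = "{1..n}"
  let ?E = "parent_edges ?V n p - {{i, p i}}"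
  define js where "js = [1..<i] @ [Suc i..<n]"
  define P where "P = rev_product (map (\<lambda>j. transpose (\<theta> j) (\<theta> (p j))) js)"
  define P' where "P' = rev_product (map (\<lambda>j. transpose j (p j)) js)"
  have p: "rooted ?V n p" and \<theta>: "\<theta> permutes ?V" "\<theta> n = n"
    and R: "hurwitz_dual F = map (\<lambda>i. transpose (\<theta> i) (\<theta> (p i))) [1..<n]"
    using dual by (auto simp: dual_tree_def)
  have FT: "set F \<subseteq> transpositions n" "length F = n - 1" "product_of F = full_cycle n"
    using F by (auto simp: factorizations_altdef)
  then have "F ! (i - 1) \<in> transpositions n"
    using nth_mem[of "i - 1" F] i by auto
  then obtain s t where st: "1 \<le> s" "s < t" "t \<le> n" "F ! (i - 1) = transpose s t"
    by (auto simp: transpositions_def)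
  have "[1..<n] = [1..<i] @ i # [Suc i..<n]"
    using i upt_add_eq_append[of 1 i "n - i"] upt_conv_Cons[of i n] by simp
  then have "hurwitz_dual F = map (\<lambda>i. transpose (\<theta> i) (\<theta> (p i))) [1..<i] @
      transpose (\<theta> i) (\<theta> (p i)) # map (\<lambda>i. transpose (\<theta> i) (\<theta> (p i))) [Suc i..<n]"
    by (simp add: R)
  from hurwitz_dual_delete[OF FT(1) this] have P: "P = transpose s t \<circ> full_cycle n"
    by (simp add: P_def js_def st(4)[simplified] FT(3))
  have comm: "\<theta> \<circ> P' = P \<circ> \<theta>"
    unfolding P_def P'_def by (rule rev_product_relabel[OF permutes_bij[OF \<theta>(1)]])
  have "\<exists>y. z = \<theta> y \<and> y \<in> orbit P' x" if "z \<in> orbit P (\<theta> x)" for x z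
    using that by induction (metis comm comp_apply orbit.base orbit.step)+
  then have orbit: "y \<in> orbit P' x" if "\<theta> y \<in> orbit P (\<theta> x)" for x y
    using that permutes_inj[OF \<theta>(1)] by (metis injD)
  have "\<exists>a b. r = transpose a b \<and> {a, b} \<in> ?E" if "r \<in> set (map (\<lambda>j. transpose j (p j)) js)" for r
  proof -
    obtain j where j: "r = transpose j (p j)" "j \<in> {1..<n}" "j \<noteq> i"
      using \<open>r \<in> _\<close> i by (auto simp: js_def)
    then have "{j, p j} \<noteq> {i, p i}"
      using inj_onD[OF inj_on_parent_edge[OF p], of j i] i by auto
    moreover have "{j, p j} \<in> parent_edges ?V n p"
      using j by (auto simp: parent_edges_def)
    ultimately show ?thesis
      using j(1) by blast
  qed
  then have con: "(x, y) \<in> (adjacency ?E)\<^sup>*" if "\<theta> y \<in> orbit P (\<theta> x)" for x y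
    using orbit[OF that] unfolding P'_def by (rule orbit_rev_product_connected)
  define A where "A = inv \<theta> ` {s..<t}"
  have A_iff: "x \<in> A \<longleftrightarrow> \<theta> x \<in> {s..<t}" for x
    unfolding A_def by (metis image_iff permutes_inverses[OF \<theta>(1)])
  have V_iff: "\<theta> x \<in> ?V \<longleftrightarrow> x \<in> ?V" for x
    by (rule permutes_in_image[OF \<theta>(1)])
  have "A \<subseteq> ?V"
    using V_iff A_iff st by fastforce
  have card_A: "card A = t - s"
    using card_image[OF inj_on_subset[OF permutes_inj[OF permutes_inv[OF \<theta>(1)]]], of "{s..<t}"]
    by (simp add: A_def)
  then have card_B: "card (?V - A) = n - (t - s)"
    using \<open>A \<subseteq> ?V\<close> by (simp add: card_Diff_subset finite_subset)
  have "graph_components ?V ?E = {A, ?V - A}"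
  proof (rule two_components)
    show "A \<noteq> {}" "?V - A \<noteq> {}"
      using card_A card_B st card_gt_0_iff[of A] card_gt_0_iff[of "?V - A"] by simp_all
    show "(x, y) \<in> (adjacency ?E)\<^sup>*" if "x \<in> A" "y \<in> A" for x y
      using that split_full_cycle(1)[OF st(1-3)] A_iff by (intro con) (simp add: P)
    show "(x, y) \<in> (adjacency ?E)\<^sup>*" if "x \<in> ?V - A" "y \<in> ?V - A" for x y
      using that split_full_cycle(2)[OF st(1-3)] A_iff V_iff by (intro con) (simp add: P)
    show "(i, p i) \<notin> (adjacency ?E)\<^sup>*"
      using parent_edge_is_bridge[OF p, of i] i by simp
    show "i \<in> ?V" "p i \<in> ?V"
      using rooted_parent_in[OF p, of i] i by auto
  qed fact
  then have "edge_deletion_index n (parent_edges ?V n p) {i, p i} = min (t - s) (n - (t - s))"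
    by (simp only: edge_deletion_index_def image_insert image_empty card_A card_B) simp
  also have "\<dots> = difference_index n (F ! (i - 1))"
    using difference_index_transpose[OF st(1-3)] st by simp
  finally show ?thesis .
qed

lemma distribution_dual:
  assumes F: "F \<in> factorizations n" and dual: "dual_tree n F \<theta> p"
  shows "difference_distribution n F = edge_deletion_distribution n (parent_edges {1..n} n p)"
proof
  fix j
  let ?T = "parent_edges {1..n} n p"
  define g where "g k = {Suc k, p (Suc k)}" for k
  have p: "rooted {1..n} n p" and len: "length F = n - 1"
    using assms by (auto simp: dual_tree_def factorizations_altdef)
  have "{1..n} - {n} = Suc ` {..<n - 1}"
    by (auto simp: image_iff) (metis Suc_diff_le Suc_le_eq diff_Suc_1 diff_less_mono le_neq_implies_less Suc_pred lessThan_iff)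
  then have T: "?T = g ` {..<n - 1}" and "inj_on (\<lambda>v. {v, p v}) (Suc ` {..<n - 1})"
    using inj_on_parent_edge[OF p] by (simp_all only: parent_edges_def g_def[abs_def] image_image)
  then have inj: "inj_on g {..<n - 1}"
    by (auto simp: inj_on_def g_def)
  have idx: "edge_deletion_index n ?T (g k) = difference_index n (F ! k)" if "k < n - 1" for k
    using edge_deletion_index_dual[OF assms, of "Suc k"] that by (simp add: g_def)
  have "{e \<in> ?T. edge_deletion_index n ?T e = j} = g ` {k. k < n - 1 \<and> difference_index n (F ! k) = j}"
  proof -
    have "{e \<in> ?T. edge_deletion_index n ?T e = j} = g ` {k\<in>{..<n - 1}. edge_deletion_index n ?T (g k) = j}"
      unfolding T by blast
    also have "{k\<in>{..<n - 1}. edge_deletion_index n ?T (g k) = j} = {k. k < n - 1 \<and> difference_index n (F ! k) = j}"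
      using idx by auto
    finally show ?thesis .
  qed
  moreover have "inj_on g {k. k < n - 1 \<and> difference_index n (F ! k) = j}"
    by (rule inj_on_subset[OF inj]) auto
  ultimately show "difference_distribution n F j = edge_deletion_distribution n ?T j"
    by (simp add: difference_distribution_def edge_deletion_distribution_def len card_image)
qed

section \<open>The bijection\<close>

theorem theorem1p1:
  fixes n :: nat
  assumes "n \<ge> 1"
  shows "\<exists>\<phi>. bij_betw \<phi> (factorizations n) (labelled_trees n) \<and>
    (\<forall>F\<in>factorizations n. difference_distribution n F = edge_deletion_distribution n (\<phi> F))"
proof -
  have "\<exists>T. \<exists>\<theta> p. dual_tree n F \<theta> p \<and> T = parent_edges {1..n} n p" if "F \<in> factorizations n" for F
    using dual_tree_exists[OF assms that] by metis
  then have "\<exists>\<phi>. \<forall>F\<in>factorizations n. \<exists>\<theta> p. dual_tree n F \<theta> p \<and> \<phi> F = parent_edges {1..n} n p"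
    by (intro bchoice) blast
  then obtain \<phi> where \<phi>: "\<And>F. F \<in> factorizations n \<Longrightarrow>
      \<exists>\<theta> p. dual_tree n F \<theta> p \<and> \<phi> F = parent_edges {1..n} n p"
    by blast
  have tree: "T \<in> labelled_trees n \<longleftrightarrow> (\<exists>p. rooted {1..n} n p \<and> T = parent_edges {1..n} n p)" for T
    using tree_graph_iff_parents[of "{1..n}" n T] assms by (simp add: labelled_trees_def)
  have "bij_betw \<phi> (factorizations n) (labelled_trees n)"
  proof (rule bij_betwI')
    show "\<phi> F = \<phi> F' \<longleftrightarrow> F = F'" if "F \<in> factorizations n" "F' \<in> factorizations n" for F F'
      using \<phi>[OF that(1)] \<phi>[OF that(2)] dual_factorization_unique[OF assms that] by metis
    show "\<phi> F \<in> labelled_trees n" if "F \<in> factorizations n" for F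
      using \<phi>[OF that] by (auto simp: tree dual_tree_def)
    show "\<exists>F\<in>factorizations n. T = \<phi> F" if "T \<in> labelled_trees n" for T
    proof -
      obtain p where p: "rooted {1..n} n p" "T = parent_edges {1..n} n p"
        using \<open>T \<in> labelled_trees n\<close> unfolding tree by blast
      obtain F \<theta> where F: "F \<in> factorizations n" "dual_tree n F \<theta> p"
        using dual_factorization_exists[OF assms p(1)] by metis
      then have "T = \<phi> F"
        using \<phi>[OF F(1)] dual_tree_unique p(2) by metis
      then show ?thesis
        using F(1) by blast
    qed
  qed
  moreover have "difference_distribution n F = edge_deletion_distribution n (\<phi> F)"
    if "F \<in> factorizations n" for F
    using \<phi>[OF that] distribution_dual[OF that] by metis
  ultimately show ?thesis
    by blast
qed

end
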